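(* Let $X$ be a locally compact Hausdorff space, $k$ a nonnegative symmetric lower semicontinuous kernel on $X$, and let $H,L\subset X$ be arbitrary subsets. Then, for every $n\ge 1$, $$R_n(H,L)=[M_n(H,L),\overline{M}_n(H,L)],\qquad R(H,L)=[M(H,L),\overline{M}(H,L)],\qquad A(H,L)=[\underline{q}(H,L),q(H,L)],$$ where $[a,b]=\emptyset$ if $b<a$. In particular, whenever the respective set is nonempty, $$\inf R_n(H,L)=M_n(H,L),\quad \sup R_n(H,L)=\overline{M}_n(H,L),\quad \inf R(H,L)=M(H,L),\quad \sup R(H,L)=\overline{M}(H,L),$$ $$\inf A(H,L)=\underline{q}(H,L),\quad \sup A(H,L)=q(H,L).$$
   Context: A nonnegative symmetric lower semicontinuous kernel on $X$ is a function $k:X\times X\to[0,+\infty]$ that is lower semicontinuous on $X\times X$ and satisfies $k(x,y)=k(y,x)$ for all $x,y\in X$. $\mathfrak{M}_1(X)$ is the set of regular Borel probability measures on $X$; each such $\mu$ is identified with its Carathéodory extension to an outer measure. For an arbitrary set $H\subset X$, $\mathfrak{M}_1(H)$ is the set of those $\mu\in\mathfrak{M}_1(X)$ that are concentrated on $H$, i.e. every compact set meets $X\setminus H$ in a set of outer $\mu$-measure zero (equivalently, since $\mu$ is finite, $H$ is $\mu$-measurable in the Carathéodory sense and $\mu(H)=1$). The potential of $\mu$ is $U^\mu(x)=\int_X k(x,y)\,d\mu(y)\in[0,+\infty]$. All suprema and infima are taken in $[0,+\infty]$. Define $$q(H,L)=\inf_{\mu\in\mathfrak{M}_1(H)}\sup_{x\in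 L}U^\mu(x),\qquad \underline{q}(H,L)=\sup_{\mu\in\mathfrak{M}_1(H)}\inf_{x\in L}U^\mu(x),$$ $$M_n(H,L)=\sup_{w_1,\dots,w_n\in H}\inf_{x\in L}\frac1n\sum_{j=1}^n k(x,w_j),\qquad \overline{M}_n(H,L)=\inf_{w_1,\dots,w_n\in H}\sup_{x\in L}\frac1n\sum_{j=1}^n k(x,w_j),$$ $$M(H,L)=\lim_{n\to\infty}M_n(H,L)=\sup_n M_n(H,L),\qquad \overline{M}(H,L)=\lim_{n\to\infty}\overline{M}_n(H,L)=\inf_n\overline{M}_n(H,L)$$ (these limits exist in $[0,+\infty]$). For $E\subset[0,+\infty]$, $\overline{\mathrm{conv}}\,E$ denotes the closed convex hull of $E$ in $[0,+\infty]$ (compact, with its usual topology). Define $$R_n(H,L)=\bigcap_{w_1,\dots,w_n\in H}\overline{\mathrm{conv}}\Big\{\tfrac1n\sum_{j=1}^n k(x,w_j): x\in L\Big\},\qquad R(H,L)=\bigcap_{n=1}^\infty R_n(H,L),$$ $$A(H,L)=\bigcap_{\mu\in\mathfrak{M}_1(H)}\overline{\mathrm{conv}}\{U^\mu(x): x\in L\}.$$ The points $w_1,\dots,w_n$ need not be distinct. These are (possibly empty) subsets of $[0,+\infty]$; an intersection over an empty family is $[0,+\infty]$. *)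

theory Defs
  imports "HOL-Probability.Probability"
begin

definition lsc_kernel :: "('a::topological_space \<Rightarrow> 'a \<Rightarrow> ennreal) \<Rightarrow> bool" where
  "lsc_kernel k \<longleftrightarrow> (\<forall>c. open {(x, y). c < k x y}) \<and> (\<forall>x y. k x y = k y x)"

definition regular_borel_measure :: "'a::topological_space measure \<Rightarrow> bool" where
  "regular_borel_measure \<mu> \<longleftrightarrow> sets \<mu> = sets borel \<and>
    (\<forall>B\<in>sets borel.
       emeasure \<mu> B = (INF U\<in>{U. open U \<and> B \<subseteq> U}. emeasure \<mu> U) \<and>
       emeasure \<mu> B = (SUP K\<in>{K. compact K \<and> K \<subseteq> B}. emeasure \<mu> K))"

text \<open>\<^const>\<open>outer_measure_of\<close> is the outer measure with which a Borel measure is identified; it is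
  needed because \<open>H\<close> is an arbitrary set.\<close>

definition concentrated_on :: "'a::topological_space measure \<Rightarrow> 'a set \<Rightarrow> bool" where
  "concentrated_on \<mu> H \<longleftrightarrow> (\<forall>K. compact K \<longrightarrow> outer_measure_of \<mu> (K \<inter> - H) = 0)"

definition prob_measures_on :: "'a::topological_space set \<Rightarrow> 'a measure set" where
  "prob_measures_on H = {\<mu>. prob_space \<mu> \<and> regular_borel_measure \<mu> \<and> concentrated_on \<mu> H}"

definition potential :: "('a \<Rightarrow> 'a \<Rightarrow> ennreal) \<Rightarrow> 'a measure \<Rightarrow> 'a \<Rightarrow> ennreal" where
  "potential k \<mu> x = (\<integral>\<^sup>+ y. k x y \<partial>\<mu>)"

definition q_upper :: "('a::topological_space \<Rightarrow> 'a \<Rightarrow> ennreal) \<Rightarrow> 'a set \<Rightarrow> 'a set \<Rightarrow> ennreal" where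
  "q_upper k H L = (INF \<mu>\<in>prob_measures_on H. SUP x\<in>L. potential k \<mu> x)"

definition q_lower :: "('a::topological_space \<Rightarrow> 'a \<Rightarrow> ennreal) \<Rightarrow> 'a set \<Rightarrow> 'a set \<Rightarrow> ennreal" where
  "q_lower k H L = (SUP \<mu>\<in>prob_measures_on H. INF x\<in>L. potential k \<mu> x)"

definition kernel_mean :: "('a \<Rightarrow> 'a \<Rightarrow> ennreal) \<Rightarrow> nat \<Rightarrow> (nat \<Rightarrow> 'a) \<Rightarrow> 'a \<Rightarrow> ennreal" where
  "kernel_mean k n w x = (1 / of_nat n) * (\<Sum>j=1..n. k x (w j))"

definition M_lower_n :: "('a \<Rightarrow> 'a \<Rightarrow> ennreal) \<Rightarrow> nat \<Rightarrow> 'a set \<Rightarrow> 'a set \<Rightarrow> ennreal" where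
  "M_lower_n k n H L = (SUP w\<in>{1..n} \<rightarrow> H. INF x\<in>L. kernel_mean k n w x)"

definition M_upper_n :: "('a \<Rightarrow> 'a \<Rightarrow> ennreal) \<Rightarrow> nat \<Rightarrow> 'a set \<Rightarrow> 'a set \<Rightarrow> ennreal" where
  "M_upper_n k n H L = (INF w\<in>{1..n} \<rightarrow> H. SUP x\<in>L. kernel_mean k n w x)"

text \<open>The limits exist, and equal the supremum and the infimum over \<open>n \<ge> 1\<close>: see
  \<open>M_lower_n_LIMSEQ\<close> and \<open>M_upper_n_LIMSEQ\<close> below.\<close>

definition M_lower :: "('a \<Rightarrow> 'a \<Rightarrow> ennreal) \<Rightarrow> 'a set \<Rightarrow> 'a set \<Rightarrow> ennreal" where
  "M_lower k H L = lim (\<lambda>n. M_lower_n k n H L)"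

definition M_upper :: "('a \<Rightarrow> 'a \<Rightarrow> ennreal) \<Rightarrow> 'a set \<Rightarrow> 'a set \<Rightarrow> ennreal" where
  "M_upper k H L = lim (\<lambda>n. M_upper_n k n H L)"

text \<open>Convexity in \<open>[0, \<infinity>]\<close> is order convexity, so the closed convex sets are the closed intervals.
  Closing under the combinations \<open>(1 - t) * a + t * b\<close> instead would make \<open>{0, \<infinity>}\<close> a closed
  convex set.\<close>

definition order_convex :: "'a::order set \<Rightarrow> bool" where
  "order_convex C \<longleftrightarrow> (\<forall>a\<in>C. \<forall>b\<in>C. {a..b} \<subseteq> C)"

definition closed_conv :: "ennreal set \<Rightarrow> ennreal set" where
  "closed_conv E = (\<lambda>C. closed C \<and> order_convex C) hull E"

definition rendezvous_n :: "('a \<Rightarrow> 'a \<Rightarrow> ennreal) \<Rightarrow> nat \<Rightarrow> 'a set \<Rightarrow> 'a set \<Rightarrow> ennreal set" where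
  "rendezvous_n k n H L = (\<Inter>w\<in>{1..n} \<rightarrow> H. closed_conv {kernel_mean k n w x |x. x \<in> L})"

definition rendezvous :: "('a \<Rightarrow> 'a \<Rightarrow> ennreal) \<Rightarrow> 'a set \<Rightarrow> 'a set \<Rightarrow> ennreal set" where
  "rendezvous k H L = (\<Inter>n\<in>{1..}. rendezvous_n k n H L)"

definition average_set ::
  "('a::topological_space \<Rightarrow> 'a \<Rightarrow> ennreal) \<Rightarrow> 'a set \<Rightarrow> 'a set \<Rightarrow> ennreal set" where
  "average_set k H L = (\<Inter>\<mu>\<in>prob_measures_on H. closed_conv {potential k \<mu> x |x. x \<in> L})"


text \<open>Existence of the limits: an \<open>m\<close>-tuple in \<open>H\<close>, extended periodically, is compared with
  \<open>N\<close>-tuples for large \<open>N\<close>.\<close>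

lemma sum_periodic:
  fixes f :: "nat \<Rightarrow> ennreal"
  assumes m: "m \<ge> 1"
  shows "(\<Sum>j=1..q*m. f ((j - 1) mod m + 1)) = of_nat q * (\<Sum>j=1..m. f j)"
proof -
  have shift: "(\<Sum>j=1..n. g j) = (\<Sum>j<n. g (Suc j))" for n and g :: "nat \<Rightarrow> ennreal"
    by (metis One_nat_def sum.atLeast1_atMost_eq)
  have blk: "(\<Sum>j=i*m..<i*m+m. f (Suc (j mod m))) = (\<Sum>j<m. f (Suc j))" for i
  proof -
    have "(\<Sum>j=i*m..<i*m+m. f (Suc (j mod m))) = (\<Sum>j\<in>{0..<m}. f (Suc ((j + i*m) mod m)))"
      using sum.shift_bounds_nat_ivl[of "\<lambda>j. f (Suc (j mod m))" 0 "i*m" m] by (simp add: add.commute)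
    also have "\<dots> = (\<Sum>j<m. f (Suc j))"
      by (rule sum.cong) auto
    finally show ?thesis .
  qed
  have "(\<Sum>j=1..q*m. f ((j - 1) mod m + 1)) = (\<Sum>j<q*m. f (Suc (j mod m)))"
    by (simp only: shift) simp
  also have "\<dots> = (\<Sum>i<q. \<Sum>j=i*m..<i*m+m. f (Suc (j mod m)))"
    by (rule sum.nat_group[symmetric])
  also have "\<dots> = of_nat q * (\<Sum>j=1..m. f j)"
    by (simp only: blk shift) simp
  finally show ?thesis .
qed

lemma kernel_mean_mult:
  assumes "n \<ge> 1"
  shows "of_nat n * kernel_mean k n w x = (\<Sum>j=1..n. k x (w j))"
proof -
  have "of_nat n * (1 / of_nat n) = (1::ennreal)"
    using assms by (simp add: ennreal_times_divide ennreal_divide_self of_nat_less_top)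
  then show ?thesis
    unfolding kernel_mean_def by (simp add: mult.assoc[symmetric])
qed

lemma frac_cancel:
  assumes "N \<ge> 1"
  shows "ennreal (real a / real N) * y = (1 / of_nat N) * (of_nat a * y)"
proof -
  have "ennreal (real a / real N) = (1 / of_nat N) * of_nat a"
    using assms by (simp add: ennreal_divide_times divide_ennreal ennreal_of_nat_eq_real_of_nat)
  then show ?thesis by (simp add: mult.assoc)
qed

lemma kernel_mean_periodic:
  fixes w :: "nat \<Rightarrow> 'a"
  assumes m: "m \<ge> 1" and N: "N \<ge> 1"
  defines "v \<equiv> \<lambda>j. w ((j - 1) mod m + 1)"
  shows "ennreal (real (N div m * m) / real N) * kernel_mean k m w x \<le> kernel_mean k N v x"
    and "kernel_mean k N v x \<le> ennreal (real (Suc (N div m) * m) / real N) * kernel_mean k m w x"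
proof -
  have per: "(\<Sum>j=1..q*m. k x (v j)) = of_nat (q * m) * kernel_mean k m w x" for q
    unfolding v_def using sum_periodic[OF m, of "\<lambda>j. k x (w j)" q] kernel_mean_mult[OF m, of k w x]
    by (simp add: mult.assoc)
  have "N div m * m \<le> N" by simp
  then have "(\<Sum>j=1..N div m * m. k x (v j)) \<le> (\<Sum>j=1..N. k x (v j))"
    by (intro sum_mono2) auto
  then show "ennreal (real (N div m * m) / real N) * kernel_mean k m w x \<le> kernel_mean k N v x"
    unfolding frac_cancel[OF N] per kernel_mean_def[of k N] by (intro mult_left_mono) auto
  have "N \<le> Suc (N div m) * m"
    using m by (metis Suc_le_eq dividend_less_div_times add.commute less_imp_le mult_Suc zero_less_one_class.zero_less_one less_le_trans)
  then have "(\<Sum>j=1..N. k x (v j)) \<le> (\<Sum>j=1..Suc (N div m) * m. k x (v j))"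
    by (intro sum_mono2) auto
  then show "kernel_mean k N v x \<le> ennreal (real (Suc (N div m) * m) / real N) * kernel_mean k m w x"
    unfolding frac_cancel[OF N] per kernel_mean_def[of k N] by (intro mult_left_mono) auto
qed

lemma periodic_in:
  fixes w :: "nat \<Rightarrow> 'a"
  assumes "(m::nat) \<ge> 1" "w \<in> {1..m} \<rightarrow> H"
  shows "(\<lambda>j. w ((j - 1) mod m + 1)) \<in> {1..N} \<rightarrow> H"
proof
  fix j :: nat
  have "(j - 1) mod m < m" using assms(1) by (intro mod_less_divisor) simp
  then have "(j - 1) mod m + 1 \<in> {1..m}" by simp
  with assms(2) show "w ((j - 1) mod m + 1) \<in> H" by (rule funcset_mem)
qed

lemma block_le:
  assumes m: "m \<ge> 1" and N: "N \<ge> 1"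
  shows "ennreal (1 - real m / real N) \<le> ennreal (real (N div m * m) / real N)"
    and "ennreal (real (Suc (N div m) * m) / real N) \<le> ennreal (1 + real m / real N)"
proof -
  have "N \<le> N div m * m + m"
    using m by (metis div_mult_mod_eq mod_less_divisor nat_add_left_cancel_le less_imp_le less_eq_Suc_le One_nat_def)
  then have "real N \<le> real (N div m * m) + real m" by linarith
  then have "(real N - real m) / real N \<le> real (N div m * m) / real N"
    by (intro divide_right_mono) auto
  then show "ennreal (1 - real m / real N) \<le> ennreal (real (N div m * m) / real N)"
    using N by (intro ennreal_leI) (simp add: diff_divide_distrib)
  have "Suc (N div m) * m \<le> N + m" by simp
  then have "real (Suc (N div m) * m) \<le> real N + real m" by linarith
  then show "ennreal (real (Suc (N div m) * m) / real N) \<le> ennreal (1 + real m / real N)"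
    using N by (intro ennreal_leI) (simp add: field_simps)
qed

lemma M_lower_n_step:
  assumes m: "m \<ge> 1" and N: "N \<ge> 1"
  shows "ennreal (1 - real m / real N) * M_lower_n k m H L \<le> M_lower_n k N H L"
proof -
  let ?c = "ennreal (1 - real m / real N)"
  have "?c * (INF x\<in>L. kernel_mean k m w x) \<le> M_lower_n k N H L" if w: "w \<in> {1..m} \<rightarrow> H" for w
  proof -
    let ?v = "\<lambda>j. w ((j - 1) mod m + 1)"
    have "?c * (INF x\<in>L. kernel_mean k m w x) \<le> (INF x\<in>L. kernel_mean k N ?v x)"
    proof (rule INF_greatest)
      fix x assume "x \<in> L"
      then have "?c * (INF x\<in>L. kernel_mean k m w x) \<le> ennreal (real (N div m * m) / real N) * kernel_mean k m w x"
        by (intro mult_mono block_le[OF m N] INF_lower) auto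
      also have "\<dots> \<le> kernel_mean k N ?v x" by (rule kernel_mean_periodic[OF m N])
      finally show "?c * (INF x\<in>L. kernel_mean k m w x) \<le> kernel_mean k N ?v x" .
    qed
    also have "\<dots> \<le> M_lower_n k N H L"
      unfolding M_lower_n_def by (rule SUP_upper[OF periodic_in[OF m w]])
    finally show ?thesis .
  qed
  then show ?thesis
    unfolding M_lower_n_def[of k m] SUP_mult_left_ennreal by (intro SUP_least) auto
qed

lemma M_upper_n_step:
  assumes m: "m \<ge> 1" and N: "N \<ge> 1"
  shows "M_upper_n k N H L \<le> ennreal (1 + real m / real N) * M_upper_n k m H L"
proof -
  let ?c = "ennreal (1 + real m / real N)"
  have step: "M_upper_n k N H L \<le> ?c * (SUP x\<in>L. kernel_mean k m w x)" if w: "w \<in> {1..m} \<rightarrow> H" for w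
  proof -
    let ?v = "\<lambda>j. w ((j - 1) mod m + 1)"
    have "M_upper_n k N H L \<le> (SUP x\<in>L. kernel_mean k N ?v x)"
      unfolding M_upper_n_def by (rule INF_lower[OF periodic_in[OF m w]])
    also have "\<dots> \<le> ?c * (SUP x\<in>L. kernel_mean k m w x)"
    proof (rule SUP_least)
      fix x assume x: "x \<in> L"
      have "kernel_mean k N ?v x \<le> ennreal (real (Suc (N div m) * m) / real N) * kernel_mean k m w x"
        by (rule kernel_mean_periodic[OF m N])
      also have "\<dots> \<le> ?c * (SUP x\<in>L. kernel_mean k m w x)"
        using x by (intro mult_mono block_le[OF m N] SUP_upper) auto
      finally show "kernel_mean k N ?v x \<le> ?c * (SUP x\<in>L. kernel_mean k m w x)" .
    qed
    finally show ?thesis .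
  qed
  have pos: "1 + real m / real N > 0" by (simp add: add_pos_nonneg)
  have inv: "ennreal (1 / (1 + real m / real N)) * ?c = 1"
    using pos by (subst ennreal_mult'[symmetric]) auto
  have "ennreal (1 / (1 + real m / real N)) * M_upper_n k N H L \<le> M_upper_n k m H L"
    unfolding M_upper_n_def[of k m]
  proof (rule INF_greatest)
    fix w assume "w \<in> {1..m} \<rightarrow> H"
    from mult_left_mono[OF step[OF this], of "ennreal (1 / (1 + real m / real N))"]
    show "ennreal (1 / (1 + real m / real N)) * M_upper_n k N H L \<le> (SUP x\<in>L. kernel_mean k m w x)"
      by (simp only: mult.assoc[symmetric] inv mult_1 zero_le)
  qed
  from mult_left_mono[OF this, of ?c] show ?thesis
    by (simp only: mult.assoc[symmetric] inv[unfolded mult.commute[of _ ?c]] mult_1 zero_le)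
qed

lemma tends_1:
  "(\<lambda>N. ennreal (1 - real m / real N)) \<longlonglongrightarrow> 1" "(\<lambda>N. ennreal (1 + real m / real N)) \<longlonglongrightarrow> 1"
proof -
  have *: "(\<lambda>N. real m / real N) \<longlonglongrightarrow> 0" by (rule lim_const_over_n)
  show "(\<lambda>N. ennreal (1 - real m / real N)) \<longlonglongrightarrow> 1"
    using tendsto_ennrealI[OF tendsto_diff[OF tendsto_const[of 1] *]] by simp
  show "(\<lambda>N. ennreal (1 + real m / real N)) \<longlonglongrightarrow> 1"
    using tendsto_ennrealI[OF tendsto_add[OF tendsto_const[of 1] *]] by simp
qed

lemma M_lower_n_LIMSEQ:
  "(\<lambda>n. M_lower_n k n H L) \<longlonglongrightarrow> (SUP n\<in>{1..}. M_lower_n k n H L)"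
proof (rule order_tendstoI)
  fix c assume "c < (SUP n\<in>{1..}. M_lower_n k n H L)"
  then obtain m where m: "m \<ge> 1" "c < M_lower_n k m H L" by (auto simp: less_SUP_iff)
  have "(\<lambda>N. ennreal (1 - real m / real N) * M_lower_n k m H L) \<longlonglongrightarrow> 1 * M_lower_n k m H L"
    by (rule tendsto_mult_ennreal[OF tends_1(1) tendsto_const]) simp
  then have "eventually (\<lambda>N. c < ennreal (1 - real m / real N) * M_lower_n k m H L) sequentially"
    using m by (intro order_tendstoD) auto
  with eventually_ge_at_top[of 1] show "eventually (\<lambda>N. c < M_lower_n k N H L) sequentially"
    by eventually_elim (use M_lower_n_step[OF m(1)] less_le_trans in blast)
next
  fix c assume c: "(SUP n\<in>{1..}. M_lower_n k n H L) < c"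
  show "eventually (\<lambda>N. M_lower_n k N H L < c) sequentially"
    using eventually_ge_at_top[of 1]
    by eventually_elim (rule le_less_trans[OF SUP_upper c], simp)
qed

lemma M_upper_n_LIMSEQ:
  "(\<lambda>n. M_upper_n k n H L) \<longlonglongrightarrow> (INF n\<in>{1..}. M_upper_n k n H L)"
proof (rule order_tendstoI)
  fix c assume "(INF n\<in>{1..}. M_upper_n k n H L) < c"
  then obtain m where m: "m \<ge> 1" "M_upper_n k m H L < c" by (auto simp: INF_less_iff)
  have "(\<lambda>N. ennreal (1 + real m / real N) * M_upper_n k m H L) \<longlonglongrightarrow> 1 * M_upper_n k m H L"
    by (rule tendsto_mult_ennreal[OF tends_1(2) tendsto_const]) simp
  then have "eventually (\<lambda>N. ennreal (1 + real m / real N) * M_upper_n k m H L < c) sequentially"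
    using m by (intro order_tendstoD) auto
  with eventually_ge_at_top[of 1] show "eventually (\<lambda>N. M_upper_n k N H L < c) sequentially"
    by eventually_elim (use M_upper_n_step[OF m(1)] le_less_trans in blast)
next
  fix c assume c: "c < (INF n\<in>{1..}. M_upper_n k n H L)"
  show "eventually (\<lambda>N. c < M_upper_n k N H L) sequentially"
    using eventually_ge_at_top[of 1]
    by eventually_elim (rule less_le_trans[OF c INF_lower], simp)
qed

lemma M_lower_eq_SUP: "M_lower k H L = (SUP n\<in>{1..}. M_lower_n k n H L)"
  unfolding M_lower_def by (rule limI[OF M_lower_n_LIMSEQ])

lemma M_upper_eq_INF: "M_upper k H L = (INF n\<in>{1..}. M_upper_n k n H L)"
  unfolding M_upper_def by (rule limI[OF M_upper_n_LIMSEQ])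

lemma M_lower_LIMSEQ: "(\<lambda>n. M_lower_n k n H L) \<longlonglongrightarrow> M_lower k H L"
  by (simp only: M_lower_eq_SUP M_lower_n_LIMSEQ)

lemma M_upper_LIMSEQ: "(\<lambda>n. M_upper_n k n H L) \<longlonglongrightarrow> M_upper k H L"
  by (simp only: M_upper_eq_INF M_upper_n_LIMSEQ)

end

theory Submission
  imports Defs
begin

text \<open>In \<open>ennreal\<close> the closed convex hull of a set is the interval from its
  infimum to its supremum (\<open>closed_conv_eq\<close>). Each of the three sets is an intersection
  of such hulls, and intersecting intervals takes the supremum of the left ends and the infimum of
  the right ends (\<open>INT_atLeastAtMost\<close>). The resulting sup-inf and inf-sup are exactly
  the defining expressions of the claimed endpoints.\<close>

lemma closed_conv_eq: "closed_conv E = {Inf E..Sup E}"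
  unfolding closed_conv_def
proof (rule hull_unique)
  show "E \<subseteq> {Inf E..Sup E}"
    by (auto intro: Inf_lower Sup_upper)
  show "closed {Inf E..Sup E} \<and> order_convex {Inf E..Sup E}"
    by (auto simp: order_convex_def intro: order_trans)
  fix C assume E: "E \<subseteq> C" and C: "closed C \<and> order_convex C"
  show "{Inf E..Sup E} \<subseteq> C"
  proof (cases "E = {}")
    case False
    \<comment> \<open>A nonempty closed set in a complete linear order contains its infimum and
      supremum; order convexity then fills in everything between.\<close>
    with E C have "Inf C \<in> C" "Sup C \<in> C"
      by (auto intro!: closed_contains_Inf_cl closed_contains_Sup_cl)
    with C have "{Inf C..Sup C} \<subseteq> C"
      by (simp add: order_convex_def)
    moreover have "{Inf E..Sup E} \<subseteq> {Inf C..Sup C}"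
      using Inf_superset_mono[OF E] Sup_subset_mono[OF E] by simp
    ultimately show ?thesis by blast
  \<comment> \<open>For empty \<open>E\<close> the infimum is \<open>top\<close> and the supremum is
    0, so the interval is empty.\<close>
  qed (simp add: bot_ennreal)
qed

text \<open>A point lies in every interval iff it is an upper bound of the left ends and a lower
  bound of the right ends. For empty \<open>I\<close> both sides are the whole lattice.\<close>

lemma INT_atLeastAtMost:
  fixes a b :: "'i \<Rightarrow> 'b::complete_lattice"
  shows "(\<Inter>i\<in>I. {a i..b i}) = {SUP i\<in>I. a i..INF i\<in>I. b i}"
  by (auto simp: SUP_le_iff le_INF_iff)

lemma rendezvous_n_eq: "rendezvous_n k n H L = {M_lower_n k n H L..M_upper_n k n H L}"
  by (simp add: rendezvous_n_def closed_conv_eq INT_atLeastAtMost M_lower_n_def M_upper_n_def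
      Setcompr_eq_image)

text \<open>Intersecting over \<open>n\<close> gives a supremum and an infimum over
  \<open>n \<ge> 1\<close>, which agree with the limits defining \<open>M_lower\<close> and
  \<open>M_upper\<close>.\<close>

lemma rendezvous_eq: "rendezvous k H L = {M_lower k H L..M_upper k H L}"
  by (simp add: rendezvous_def rendezvous_n_eq INT_atLeastAtMost M_lower_eq_SUP M_upper_eq_INF)

lemma average_set_eq: "average_set k H L = {q_lower k H L..q_upper k H L}"
  by (simp add: average_set_def closed_conv_eq INT_atLeastAtMost q_lower_def q_upper_def
      Setcompr_eq_image)

theorem proposition4p3:
  fixes k :: "'a::t2_space \<Rightarrow> 'a \<Rightarrow> ennreal" and H L :: "'a set"
  assumes "locally_compact_space (euclidean :: 'a topology)"
    and "lsc_kernel k"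
  shows "(\<forall>n\<ge>1. rendezvous_n k n H L = {M_lower_n k n H L..M_upper_n k n H L}) \<and>
    rendezvous k H L = {M_lower k H L..M_upper k H L} \<and>
    average_set k H L = {q_lower k H L..q_upper k H L} \<and>
    (\<forall>n\<ge>1. rendezvous_n k n H L \<noteq> {} \<longrightarrow>
      Inf (rendezvous_n k n H L) = M_lower_n k n H L \<and>
      Sup (rendezvous_n k n H L) = M_upper_n k n H L) \<and>
    (rendezvous k H L \<noteq> {} \<longrightarrow>
      Inf (rendezvous k H L) = M_lower k H L \<and>
      Sup (rendezvous k H L) = M_upper k H L) \<and>
    (average_set k H L \<noteq> {} \<longrightarrow>
      Inf (average_set k H L) = q_lower k H L \<and>
      Sup (average_set k H L) = q_upper k H L)"
  \<comment> \<open>A nonempty interval has its endpoints as infimum and supremum, which settles the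
    last three conjuncts.\<close>
  by (simp add: rendezvous_n_eq rendezvous_eq average_set_eq)

end
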